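(* Let $n\ge 1$ be an integer. The functions $f:\Gamma_n\to\mathbb{N}^{n-1}$ given by $f(I)=\mathrm{pv}_n(I)$ and $g:\mathbb{N}^{n-1}\to\Gamma_n$ given by $g(v)=I(\mathcal{A}_v)$ are inverse functions. Therefore, $f$ is a one-to-one correspondence between numerical sets closed under addition by the element $n$ and $(n-1)$-tuples of positive integers.
   Context: $\mathbb{N}$ and $\mathbb{N}_0$ denote the positive and the nonnegative integers. A numerical set is a subset $I\subseteq\mathbb{N}_0$ that contains $0$ and has finite complement in $\mathbb{N}_0$. For a positive integer $n$, $\Gamma_n$ is the collection of numerical sets $I$ such that $n+i\in I$ for all $i\in I$. For $I\in\Gamma_n$, the Apéry set is $\mathrm{Ap}(I,n)=\{w\in I: w-n\notin I\}$; it has exactly $n$ elements, including $0$. Position vector: enumerate $I=\{\lambda_0,\lambda_1,\lambda_2,\dots\}$ in increasing order and write $\mathrm{Ap}(I,n)=\{\lambda_0,\lambda_{x_1},\dots,\lambda_{x_{n-1}}\}$ with $0<x_1<\dots<x_{n-1}$. Then $\mathrm{pv}_n(I)=(x_1,\,x_2-x_1,\,x_3-x_2,\dots,x_{n-1}-x_{n-2})\in\mathbb{N}^{n-1}$. Conversion vector: for a permutation $\pi=[\pi_1\cdots\pi_m]$ of $\{1,\dots,m\}$ (one-line notation), its conversion vector is $(r_1,\dots,r_m)$ with $r_i=|\{j: j<i \text{ and } \pi_j<\pi_i\}|$. Every vector $(r_1,\dots,r_m)$ of integers with $0\le r_i\le i-1$ for all $i$ is the conversion vector of a unique permutation of $\{1,\dots,m\}$.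 Definition of $I(\mathcal{A}_v)$: given $v=(v_1,\dots,v_{n-1})\in\mathbb{N}^{n-1}$, define recursively (1) $t_1=0$ and $t_i=(v_i+t_{i-1})\bmod i$ (the remainder in $\{0,\dots,i-1\}$) for $2\le i\le n-1$; (2) $l_1=v_1-1$ and $l_i=l_{i-1}+\frac{v_i+t_{i-1}-t_i}{i}$ for $2\le i\le n-1$. Let $\sigma=[\sigma_1\cdots\sigma_{n-1}]$ be the unique permutation of $\{1,\dots,n-1\}$ whose conversion vector is $(t_1,\dots,t_{n-1})$. Set $\mathcal{A}_v=\{0\}\cup\{nl_i+\sigma_i: 1\le i\le n-1\}$, a complete residue system modulo $n$ containing $0$, and $I(\mathcal{A}_v)=\{w+kn: w\in\mathcal{A}_v,\ k\ge 0\}$, which is an element of $\Gamma_n$. *)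

theory Defs
  imports
    "HOL-Library.Infinite_Set"
    "HOL-Library.FuncSet"
    "HOL-Combinatorics.Multiset_Permutations"
begin

definition numerical_set :: "nat set \<Rightarrow> bool" where
  "numerical_set I \<longleftrightarrow> 0 \<in> I \<and> finite (- I)"

definition Gamma :: "nat \<Rightarrow> nat set set" where
  "Gamma n = {I. numerical_set I \<and> (\<forall>i\<in>I. n + i \<in> I)}"

text \<open>The difference \<open>w - n\<close> is taken in the integers: truncated subtraction would
  wrongly exclude every \<open>w < n\<close>.\<close>

definition Apery :: "nat set \<Rightarrow> nat \<Rightarrow> nat set" where
  "Apery I n = {w \<in> I. int w - int n \<notin> int ` I}"

text \<open>The increasing list \<open>[x\<^sub>1, \<dots>, x\<^sub>n\<^sub>-\<^sub>1]\<close> of the nonzero positions of the Apery set in the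
  enumeration of \<open>I\<close>. Lists are indexed from 0, so \<open>x\<^sub>i\<close> is \<open>apery_positions n I ! (i - 1)\<close>;
  the same shift applies to all lists below.\<close>

definition apery_positions :: "nat \<Rightarrow> nat set \<Rightarrow> nat list" where
  "apery_positions n I =
     sorted_list_of_set {k. 0 < k \<and> Infinite_Set.enumerate I k \<in> Apery I n}"

definition pv :: "nat \<Rightarrow> nat set \<Rightarrow> nat list" where
  "pv n I = (let x = apery_positions n I in
     map (\<lambda>i. if i = 0 then x ! 0 else x ! i - x ! (i - 1)) [0..<length x])"

definition pos_vectors :: "nat \<Rightarrow> nat list set" where
  "pos_vectors m = {v. length v = m \<and> (\<forall>a\<in>set v. 0 < a)}"

text \<open>For a permutation given as a list in one-line notation.\<close>

definition conversion_vector :: "nat list \<Rightarrow> nat list" where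
  "conversion_vector p = map (\<lambda>i. card {j. j < i \<and> p ! j < p ! i}) [0..<length p]"

text \<open>\<open>t_entry v i\<close> and \<open>l_entry v i\<close> are \<open>t\<^sub>i\<close> and \<open>l\<^sub>i\<close> for \<open>1 \<le> i \<le> length v\<close>; the values
  at \<open>i = 0\<close> are junk.\<close>

fun t_entry :: "nat list \<Rightarrow> nat \<Rightarrow> nat" where
  "t_entry v 0 = 0"
| "t_entry v (Suc 0) = 0"
| "t_entry v (Suc (Suc i)) = (v ! Suc i + t_entry v (Suc i)) mod Suc (Suc i)"

text \<open>For positive vectors the natural-number operations here are exact: \<open>v\<^sub>1 \<ge> 1\<close>, and
  \<open>t\<^sub>i\<close> is the remainder of \<open>v\<^sub>i + t\<^sub>i\<^sub>-\<^sub>1\<close> modulo \<open>i\<close>, so that \<open>v\<^sub>i + t\<^sub>i\<^sub>-\<^sub>1 - t\<^sub>i\<close> is a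
  nonnegative multiple of \<open>i\<close>.\<close>

fun l_entry :: "nat list \<Rightarrow> nat \<Rightarrow> nat" where
  "l_entry v 0 = 0"
| "l_entry v (Suc 0) = v ! 0 - 1"
| "l_entry v (Suc (Suc i)) = l_entry v (Suc i) +
     (v ! Suc i + t_entry v (Suc i) - t_entry v (Suc (Suc i))) div Suc (Suc i)"

definition sigma_perm :: "nat list \<Rightarrow> nat list" where
  "sigma_perm v = (THE p. p \<in> permutations_of_set {1..length v} \<and>
     conversion_vector p = map (t_entry v) [1..<Suc (length v)])"

definition A_set :: "nat \<Rightarrow> nat list \<Rightarrow> nat set" where
  "A_set n v = {0} \<union> {n * l_entry v i + sigma_perm v ! (i - 1) | i. 1 \<le> i \<and> i \<le> n - 1}"

definition I_set :: "nat \<Rightarrow> nat set \<Rightarrow> nat set" where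
  "I_set n A = {w + k * n | w k. w \<in> A}"

end

theory Submission
  imports Defs
begin

text \<open>
  A set \<open>I \<in> \<Gamma>\<^sub>n\<close> is determined by its Apery set, which has one element in each residue class
  modulo \<open>n\<close>. Let \<open>w\<^sub>1 < \<dots> < w\<^sub>n\<^sub>-\<^sub>1\<close> be the nonzero Apery elements, and write
  \<open>w\<^sub>i = n l\<^sub>i + s\<^sub>i\<close> with \<open>0 < s\<^sub>i < n\<close>; the \<open>s\<^sub>i\<close> form a permutation of \<open>{1, \<dots>, n - 1}\<close>, with
  conversion vector \<open>r\<close>, say. The position \<open>x\<^sub>i\<close> of \<open>w\<^sub>i\<close> in \<open>I\<close> is the number of smaller elements of
  \<open>I\<close>, and these can be counted class by class: the class of \<open>0\<close> contributes \<open>l\<^sub>i + 1\<close>, the class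
  of \<open>w\<^sub>j\<close> with \<open>j < i\<close> contributes \<open>l\<^sub>i - l\<^sub>j\<close>, and one more if \<open>s\<^sub>j < s\<^sub>i\<close>, and the other classes
  contribute nothing. Hence \<open>x\<^sub>i = 1 + i l\<^sub>i - (l\<^sub>1 + \<dots> + l\<^sub>i\<^sub>-\<^sub>1) + r\<^sub>i\<close> (lemma \<open>Apery_position\<close>),
  and the differences are \<open>x\<^sub>i - x\<^sub>i\<^sub>-\<^sub>1 = i (l\<^sub>i - l\<^sub>i\<^sub>-\<^sub>1) + r\<^sub>i - r\<^sub>i\<^sub>-\<^sub>1\<close> (lemma \<open>pv_nth_Suc\<close>).

  Since \<open>0 \<le> r\<^sub>i < i\<close>, this equation is a division with remainder of \<open>v\<^sub>i + r\<^sub>i\<^sub>-\<^sub>1\<close> by \<open>i\<close>, where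
  \<open>v\<close> is the position vector; so it is the recursion that defines \<open>t\<^sub>i\<close> and \<open>l\<^sub>i\<close> from \<open>v\<close>
  (lemma \<open>entry_recurrence\<close>). As a permutation is determined by its conversion vector, \<open>\<A>\<^sub>v\<close> is the
  Apery set of \<open>I\<close> (lemma \<open>A_set_pv\<close>).

  For the other composition, start from a positive vector \<open>v\<close>. Positivity makes the elements
  \<open>n l\<^sub>i + \<sigma>\<^sub>i\<close> increase with \<open>i\<close>: if \<open>l\<^sub>i = l\<^sub>i\<^sub>-\<^sub>1\<close>, then \<open>t\<^sub>i > t\<^sub>i\<^sub>-\<^sub>1\<close>, which forces
  \<open>\<sigma>\<^sub>i > \<sigma>\<^sub>i\<^sub>-\<^sub>1\<close> (lemma \<open>A_set_apery_list\<close>). So they are the sorted Apery elements of \<open>I(\<A>\<^sub>v)\<close>, and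
  the same equation gives back \<open>v\<close> (lemma \<open>pv_I_set_A_set\<close>).
\<close>

section \<open>Permutations and their conversion vectors\<close>

lemma length_conversion_vector [simp]: "length (conversion_vector p) = length p"
  by (simp add: conversion_vector_def)

lemma nth_conversion_vector:
  "i < length p \<Longrightarrow> conversion_vector p ! i = card {j. j < i \<and> p ! j < p ! i}"
  by (simp add: conversion_vector_def)

lemma conversion_vector_le:
  assumes "i < length p"
  shows "conversion_vector p ! i \<le> i"
proof -
  have "card {j. j < i \<and> p ! j < p ! i} \<le> card {..<i}"
    by (rule card_mono) auto
  then show ?thesis using assms by (simp add: nth_conversion_vector)
qed

lemma card_conversion_mono:
  fixes p :: "nat list"
  assumes "a \<le> b"
  shows "card {k. k < i \<and> p ! k < a} \<le> card {k. k < i \<and> p ! k < b}"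
  using assms by (intro card_mono) auto

text \<open>The entry at \<open>i\<close> says how many of the earlier values lie below \<open>p ! i\<close>, and these are
  the smallest of the earlier values; so it decides every comparison of \<open>p ! i\<close> with an earlier
  value, once the earlier values have been compared among themselves.\<close>

lemma conversion_vector_less_iff:
  assumes "distinct p" "i < length p" "j < i"
  shows "p ! j < p ! i \<longleftrightarrow> card {k. k < i \<and> p ! k < p ! j} < conversion_vector p ! i"
proof
  assume less: "p ! j < p ! i"
  have "{k. k < i \<and> p ! k < p ! j} \<subset> {k. k < i \<and> p ! k < p ! i}"
    using less assms(3) by auto
  then have "card {k. k < i \<and> p ! k < p ! j} < card {k. k < i \<and> p ! k < p ! i}"
    by (intro psubset_card_mono) auto
  then show "card {k. k < i \<and> p ! k < p ! j} < conversion_vector p ! i"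
    using assms by (simp add: nth_conversion_vector)
next
  assume c: "card {k. k < i \<and> p ! k < p ! j} < conversion_vector p ! i"
  show "p ! j < p ! i"
  proof (rule ccontr)
    assume "\<not> p ! j < p ! i"
    then have "card {k. k < i \<and> p ! k < p ! i} \<le> card {k. k < i \<and> p ! k < p ! j}"
      by (intro card_conversion_mono) auto
    then show False using c assms by (simp add: nth_conversion_vector)
  qed
qed

lemma order_iso_if_conversion_vector_eq:
  assumes p: "distinct p" and q: "distinct q"
    and eq: "conversion_vector p = conversion_vector q"
    and "i < length p" "j < length p"
  shows "p ! i < p ! j \<longleftrightarrow> q ! i < q ! j"
proof -
  have len: "length p = length q" using eq by (metis length_conversion_vector)
  have "\<forall>i<m. \<forall>j<m. p ! i < p ! j \<longleftrightarrow> q ! i < q ! j" if "m \<le> length p" for m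
    using that
  proof (induction m)
    case 0
    then show ?case by simp
  next
    case (Suc m)
    have IH: "p ! i < p ! j \<longleftrightarrow> q ! i < q ! j" if "i < m" "j < m" for i j
      using Suc that by simp
    have new: "p ! j < p ! m \<longleftrightarrow> q ! j < q ! m" if "j < m" for j
    proof -
      have "{k. k < m \<and> p ! k < p ! j} = {k. k < m \<and> q ! k < q ! j}"
        using IH that by auto
      then show ?thesis
        using conversion_vector_less_iff[of p m j] conversion_vector_less_iff[of q m j]
          p q Suc.prems len eq that by simp
    qed
    have new': "p ! m < p ! j \<longleftrightarrow> q ! m < q ! j" if "j < m" for j
    proof -
      have "p ! m \<noteq> p ! j" "q ! m \<noteq> q ! j"
        using that Suc.prems len p q by (auto simp: nth_eq_iff_index_eq)
      then show ?thesis using new[OF that] by linarith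
    qed
    show ?case
      using IH new new' by (auto simp: less_Suc_eq)
  qed
  from this[of "length p"] show ?thesis using assms by simp
qed

text \<open>The tool for passing between values of a permutation and counts of indices: the values up
  to \<open>x\<close> are all attained, each once.\<close>

lemma card_permutation_le:
  assumes "p \<in> permutations_of_set {1..m}" "x \<le> m"
  shows "card {j. j < m \<and> p ! j \<le> x} = x"
proof -
  have p: "set p = {1..m}" "distinct p" using permutations_of_setD[OF assms(1)] by auto
  then have len: "length p = m" using distinct_card[of p] by simp
  have "inj_on ((!) p) {j. j < m \<and> p ! j \<le> x}"
    using p(2) len by (intro inj_on_nth) auto
  moreover have "(!) p ` {j. j < m \<and> p ! j \<le> x} = {1..x}"
  proof (intro equalityI subsetI)
    fix a assume "a \<in> (!) p ` {j. j < m \<and> p ! j \<le> x}"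
    then obtain j where "j < m" "p ! j \<le> x" "a = p ! j" by auto
    moreover have "p ! j \<in> {1..m}" using \<open>j < m\<close> len p(1) nth_mem by metis
    ultimately show "a \<in> {1..x}" by simp
  next
    fix a assume "a \<in> {1..x}"
    then have "a \<in> set p" using p(1) assms(2) by simp
    then obtain j where "j < m" "a = p ! j" using len by (metis in_set_conv_nth)
    then show "a \<in> (!) p ` {j. j < m \<and> p ! j \<le> x}" using \<open>a \<in> {1..x}\<close> by auto
  qed
  ultimately show ?thesis using card_image by fastforce
qed

lemma length_permutation: "p \<in> permutations_of_set {1..m::nat} \<Longrightarrow> length p = m"
  by (metis card_atLeastAtMost diff_Suc_1 distinct_card permutations_of_setD)

lemma permutation_eq_if_conversion_vector_eq:
  assumes p: "p \<in> permutations_of_set {1..m}" and q: "q \<in> permutations_of_set {1..m}"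
    and eq: "conversion_vector p = conversion_vector q"
  shows "p = q"
proof (rule nth_equalityI)
  show "length p = length q" using p q by (simp add: length_permutation)
next
  fix i assume "i < length p"
  then have i: "i < m" using p by (simp add: length_permutation)
  \<comment> \<open>A value of a permutation is determined by the number of values below it.\<close>
  have val: "r ! i = Suc (card {j. j < m \<and> r ! j < r ! i})"
    if r: "r \<in> permutations_of_set {1..m}" for r
  proof -
    have "r ! i \<in> {1..m}"
      using r i by (metis length_permutation nth_mem permutations_of_setD(1))
    then have ri: "1 \<le> r ! i" "r ! i \<le> m" by simp_all
    then have "{j. j < m \<and> r ! j < r ! i} = {j. j < m \<and> r ! j \<le> r ! i - 1}" by auto
    moreover have "card {j. j < m \<and> r ! j \<le> r ! i - 1} = r ! i - 1"
      using ri by (intro card_permutation_le[OF r]) simp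
    ultimately have c: "card {j. j < m \<and> r ! j < r ! i} = r ! i - 1" by (simp only:)
    show ?thesis unfolding c using ri(1) by simp
  qed
  have "{j. j < m \<and> p ! j < p ! i} = {j. j < m \<and> q ! j < q ! i}"
    using order_iso_if_conversion_vector_eq[OF permutations_of_setD(2)[OF p]
        permutations_of_setD(2)[OF q] eq, of _ i] i length_permutation[OF p]
    by (intro Collect_cong) (simp cong: conj_cong)
  then have "Suc (card {j. j < m \<and> p ! j < p ! i}) = Suc (card {j. j < m \<and> q ! j < q ! i})"
    by (rule arg_cong)
  then show "p ! i = q ! i" unfolding val[OF p, symmetric] val[OF q, symmetric] .
qed

text \<open>A permutation with a prescribed conversion vector is built from left to right: to append
  an entry \<open>x\<close> to the vector, append the value \<open>Suc x\<close> and shift the values above \<open>x\<close>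
  up by one, which keeps the order of the earlier values.\<close>

lemma ex_permutation_conversion_vector:
  assumes "\<And>i. i < length r \<Longrightarrow> r ! i \<le> i"
  shows "\<exists>p \<in> permutations_of_set {1..length r}. conversion_vector p = r"
  using assms
proof (induction r rule: rev_induct)
  case Nil
  then show ?case by (simp add: conversion_vector_def)
next
  case (snoc x r)
  define m where "m = length r"
  have "r ! i \<le> i" if "i < length r" for i
    using snoc.prems[of i] that by (simp add: nth_append)
  then obtain p where p: "p \<in> permutations_of_set {1..m}" "conversion_vector p = r"
    using snoc.IH m_def by auto
  have x: "x \<le> m" using snoc.prems[of m] m_def by simp
  have len: "length p = m" using p(1) by (rule length_permutation)
  have sp: "set p = {1..m}" "distinct p" using permutations_of_setD[OF p(1)] by auto
  define s where "s = (\<lambda>a. if a \<le> x then a else Suc a)"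
  have s: "s a < s b \<longleftrightarrow> a < b" for a b by (auto simp: s_def)
  have s': "s a < Suc x \<longleftrightarrow> a \<le> x" for a by (auto simp: s_def)
  have sx: "Suc x \<noteq> s a" for a by (auto simp: s_def)
  have sinj: "inj s" by (rule injI) (metis s linorder_less_linear less_irrefl)
  define q where "q = map s p @ [Suc x]"
  have dq: "distinct q"
    using sp(2) sinj sx by (auto simp: q_def distinct_map inj_on_def)
  have "set q = {1..Suc m}"
  proof (rule card_subset_eq)
    show "set q \<subseteq> {1..Suc m}" using sp(1) x by (auto simp: q_def s_def)
    from dq show "card (set q) = card {1..Suc m}"
      by (subst distinct_card) (simp_all add: q_def len)
  qed simp
  moreover note dq
  moreover have "conversion_vector q = r @ [x]"
  proof (rule nth_equalityI)
    show "length (conversion_vector q) = length (r @ [x])" by (simp add: q_def len m_def)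
  next
    fix i assume "i < length (conversion_vector q)"
    then have "i < length q" by simp
    then consider "i < m" | "i = m" by (fastforce simp: q_def len less_Suc_eq)
    then show "conversion_vector q ! i = (r @ [x]) ! i"
    proof cases
      case 1
      then have "{j. j < i \<and> q ! j < q ! i} = {j. j < i \<and> p ! j < p ! i}"
        by (auto simp: q_def nth_append len s)
      then have "conversion_vector q ! i = conversion_vector p ! i"
        using 1 \<open>i < length q\<close> len by (simp add: nth_conversion_vector)
      then show ?thesis using p(2) 1 by (simp add: nth_append m_def)
    next
      case 2
      then have "{j. j < i \<and> q ! j < q ! i} = {j. j < m \<and> p ! j \<le> x}"
        by (auto simp: q_def nth_append len s')
      then show ?thesis
        using 2 \<open>i < length q\<close> card_permutation_le[OF p(1) x]
        by (simp add: nth_conversion_vector nth_append m_def)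
    qed
  qed
  ultimately show ?case by (intro bexI[of _ q]) (auto simp: m_def)
qed

section \<open>The permutation attached to a vector\<close>

lemma t_entry_less:
  assumes "0 < i"
  shows "t_entry v i < i"
proof -
  obtain k where "i = Suc k" using assms by (cases i) auto
  then show ?thesis by (cases k) auto
qed

lemma sigma_perm:
  shows sigma_perm_in: "sigma_perm v \<in> permutations_of_set {1..length v}"
    and conversion_vector_sigma_perm:
      "conversion_vector (sigma_perm v) = map (t_entry v) [1..<Suc (length v)]"
proof -
  let ?r = "map (t_entry v) [1..<Suc (length v)]"
  have "?r ! i \<le> i" if "i < length ?r" for i
    using that t_entry_less[of "Suc i" v] by (simp del: upt_Suc)
  then have "\<exists>p \<in> permutations_of_set {1..length v}. conversion_vector p = ?r"
    using ex_permutation_conversion_vector[of ?r] by (simp del: upt_Suc)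
  then have "\<exists>!p. p \<in> permutations_of_set {1..length v} \<and> conversion_vector p = ?r"
    using permutation_eq_if_conversion_vector_eq by metis
  from theI'[OF this] show "sigma_perm v \<in> permutations_of_set {1..length v}"
    "conversion_vector (sigma_perm v) = ?r"
    unfolding sigma_perm_def by auto
qed

lemma sigma_perm_eqI:
  assumes "p \<in> permutations_of_set {1..length v}"
    and "conversion_vector p = map (t_entry v) [1..<Suc (length v)]"
  shows "sigma_perm v = p"
  using permutation_eq_if_conversion_vector_eq[OF sigma_perm_in assms(1)]
    conversion_vector_sigma_perm assms(2) by simp

text \<open>Division with remainder, in a form without subtraction and division. The position vector
  of a set satisfies the same equation, with the conversion entries and quotients of its Apery
  elements in place of \<open>t_entry\<close> and \<open>l_entry\<close>.\<close>

lemma entry_recurrence: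
  "v ! Suc i + t_entry v (Suc i) + l_entry v (Suc i) * Suc (Suc i)
    = l_entry v (Suc (Suc i)) * Suc (Suc i) + t_entry v (Suc (Suc i))"
proof -
  define a where "a = v ! Suc i + t_entry v (Suc i)"
  have "(a - a mod Suc (Suc i)) div Suc (Suc i) * Suc (Suc i) + a mod Suc (Suc i) = a"
    by (simp only: minus_mod_eq_div_mult nonzero_mult_div_cancel_right[OF nat.distinct(2)]
        div_mult_mod_eq)
  moreover have "l_entry v (Suc (Suc i))
      = l_entry v (Suc i) + (a - a mod Suc (Suc i)) div Suc (Suc i)"
    "t_entry v (Suc (Suc i)) = a mod Suc (Suc i)" by (simp_all add: a_def)
  ultimately show ?thesis unfolding a_def[symmetric]
    by (simp only: distrib_right)
qed

section \<open>Sets given by their Apery set\<close>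

text \<open>For positive \<open>n\<close> these are exactly the lists that occur as the sorted nonzero part of the Apery set of some
  member of \<open>Gamma n\<close>, so that \<open>Gamma n\<close> can be parametrized by them.\<close>

definition apery_list :: "nat \<Rightarrow> nat list \<Rightarrow> bool" where
  "apery_list n w \<longleftrightarrow> sorted_wrt (<) w \<and>
     map (\<lambda>x. x mod n) w \<in> permutations_of_set {1..n - 1}"

lemma mem_I_set: "y \<in> I_set n A \<longleftrightarrow> (\<exists>a\<in>A. a \<le> y \<and> y mod n = a mod n)"
proof
  assume "y \<in> I_set n A"
  then obtain a k where "a \<in> A" "y = a + k * n" by (auto simp: I_set_def)
  then show "\<exists>a\<in>A. a \<le> y \<and> y mod n = a mod n"
    by (intro bexI[of _ a]) simp_all
next
  assume "\<exists>a\<in>A. a \<le> y \<and> y mod n = a mod n"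
  then obtain a where "a \<in> A" "a \<le> y" "y mod n = a mod n" by auto
  moreover from this obtain k where "y = a + k * n"
    by (metis mod_eq_nat1E mult.commute)
  ultimately show "y \<in> I_set n A" by (auto simp: I_set_def)
qed

lemma less_iff_div_mod:
  fixes x y n :: nat
  shows "x < y \<longleftrightarrow> x div n < y div n \<or> x div n = y div n \<and> x mod n < y mod n"
proof (cases "x div n = y div n")
  case True
  then have "x = n * (y div n) + x mod n" "y = n * (y div n) + y mod n"
    by (metis mult_div_mod_eq)+
  then have "x < y \<longleftrightarrow> x mod n < y mod n" by linarith
  then show ?thesis using True by simp
next
  case False
  have "x div n \<le> y div n" if "x < y" using that by (simp add: div_le_mono)
  moreover have "y div n \<le> x div n" if "\<not> x < y" using that by (simp add: div_le_mono)
  ultimately show ?thesis using False by linarith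
qed

lemma apery_listD:
  assumes "apery_list n w"
  shows apery_list_length: "length w = n - 1"
    and apery_list_residues: "(\<lambda>x. x mod n) ` set w = {1..n - 1}"
    and apery_list_nth_mod_eq_iff: "\<And>i j. i < length w \<Longrightarrow> j < length w
      \<Longrightarrow> w ! i mod n = w ! j mod n \<longleftrightarrow> i = j"
    and apery_list_nth_less_iff: "\<And>i j. i < length w \<Longrightarrow> j < length w
      \<Longrightarrow> w ! i < w ! j \<longleftrightarrow> i < j"
proof -
  have p: "map (\<lambda>x. x mod n) w \<in> permutations_of_set {1..n - 1}" and s: "sorted_wrt (<) w"
    using assms by (auto simp: apery_list_def)
  show "length w = n - 1" using length_permutation[OF p] by simp
  show "(\<lambda>x. x mod n) ` set w = {1..n - 1}" using permutations_of_setD(1)[OF p] by simp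
  show "w ! i mod n = w ! j mod n \<longleftrightarrow> i = j" if "i < length w" "j < length w" for i j
    using nth_eq_iff_index_eq[OF permutations_of_setD(2)[OF p], of i j] that by simp
  show "w ! i < w ! j \<longleftrightarrow> i < j" if "i < length w" "j < length w" for i j
    using sorted_wrt_nth_less[OF s, of i j] sorted_wrt_nth_less[OF s, of j i] that
    by (metis less_asym less_irrefl linorder_neqE_nat)
qed

lemma apery_list_mod_pos:
  assumes "apery_list n w" "a \<in> set w"
  shows "0 < a mod n"
proof -
  have "a mod n \<in> {1..n - 1}" using apery_list_residues[OF assms(1)] assms(2) by blast
  then show ?thesis by simp
qed

lemma apery_list_inj:
  assumes "apery_list n w" "a \<in> insert 0 (set w)" "b \<in> insert 0 (set w)" "a mod n = b mod n"
  shows "a = b"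
  using assms apery_list_mod_pos[OF assms(1)] apery_list_nth_mod_eq_iff[OF assms(1)]
  by (metis in_set_conv_nth insertE less_irrefl mod_0)

lemma apery_list_surj:
  assumes "apery_list n w" "0 < n"
  obtains a where "a \<in> insert 0 (set w)" "a mod n = y mod n"
proof (cases "y mod n = 0")
  case True
  then show ?thesis using that[of 0] by simp
next
  case False
  moreover have "y mod n < n" using assms(2) by simp
  ultimately have "y mod n \<in> {1..n - 1}" by auto
  then have "y mod n \<in> (\<lambda>x. x mod n) ` set w" using apery_list_residues[OF assms(1)] by simp
  then obtain a where "a \<in> set w" "y mod n = a mod n" by blast
  then show ?thesis using that[of a] by simp
qed

text \<open>Every residue class is represented, and from its representative on it lies in the set;
  therefore only numbers below the largest representative can be missing.\<close>

lemma I_set_in_Gamma: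
  assumes w: "apery_list n w" and n: "0 < n"
  shows "I_set n (insert 0 (set w)) \<in> Gamma n"
proof -
  let ?I = "I_set n (insert 0 (set w))"
  have "- ?I \<subseteq> {..Max (insert 0 (set w))}"
  proof
    fix y assume y: "y \<in> - ?I"
    obtain a where a: "a \<in> insert 0 (set w)" "a mod n = y mod n"
      using apery_list_surj[OF w n] .
    then have "y < a" using y by (auto simp: mem_I_set not_le)
    moreover have "a \<le> Max (insert 0 (set w))" using a(1) by (intro Max_ge) auto
    ultimately show "y \<in> {..Max (insert 0 (set w))}" by simp
  qed
  then have "finite (- ?I)" by (rule finite_subset) simp
  moreover have "0 \<in> ?I" by (simp add: mem_I_set)
  moreover have "n + y \<in> ?I" if "y \<in> ?I" for y
    using that unfolding mem_I_set by (metis mod_add_self1 trans_le_add2)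
  ultimately show ?thesis by (auto simp: Gamma_def numerical_set_def)
qed

lemma Apery_iff: "w \<in> Apery I n \<longleftrightarrow> w \<in> I \<and> (n \<le> w \<longrightarrow> w - n \<notin> I)"
proof -
  have "int w - int n \<in> int ` I \<longleftrightarrow> n \<le> w \<and> w - n \<in> I"
  proof
    assume "int w - int n \<in> int ` I"
    then obtain i where "i \<in> I" "int w - int n = int i" by auto
    moreover from this have "w = i + n" by linarith
    ultimately show "n \<le> w \<and> w - n \<in> I" by simp
  next
    assume "n \<le> w \<and> w - n \<in> I"
    then show "int w - int n \<in> int ` I" by (metis image_eqI of_nat_diff)
  qed
  then show ?thesis by (auto simp: Apery_def)
qed

lemma Apery_I_set:
  assumes w: "apery_list n w" and n: "0 < n"
  shows "Apery (I_set n (insert 0 (set w))) n = insert 0 (set w)"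
proof (intro equalityI subsetI)
  fix y assume "y \<in> Apery (I_set n (insert 0 (set w))) n"
  then obtain a where a: "a \<in> insert 0 (set w)" "a \<le> y" "y mod n = a mod n"
    and y: "n \<le> y \<longrightarrow> y - n \<notin> I_set n (insert 0 (set w))"
    by (auto simp: Apery_iff mem_I_set)
  show "y \<in> insert 0 (set w)"
  proof (rule ccontr)
    assume "y \<notin> insert 0 (set w)"
    then have "a < y" using a by (metis le_neq_implies_less)
    obtain k where k: "y = a + n * k" using a(2,3) by (metis mod_eq_nat1E)
    with \<open>a < y\<close> obtain k' where "k = Suc k'" by (cases k) auto
    then have "y = a + n * k' + n" using k by simp
    then have "n \<le> y" "y - n = a + n * k'" by auto
    then show False using y a(1) by (auto simp: mem_I_set)
  qed
next
  fix y assume y: "y \<in> insert 0 (set w)"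
  have "y - n \<notin> I_set n (insert 0 (set w))" if "n \<le> y"
  proof
    assume "y - n \<in> I_set n (insert 0 (set w))"
    then obtain a where a: "a \<in> insert 0 (set w)" "a \<le> y - n" "(y - n) mod n = a mod n"
      unfolding mem_I_set by blast
    then have "y mod n = a mod n" using that by (simp add: le_mod_geq)
    then have "y = a" using apery_list_inj[OF w y a(1)] by simp
    then show False using a(2) that n by simp
  qed
  then show "y \<in> Apery (I_set n (insert 0 (set w))) n"
    using y by (auto simp: Apery_iff mem_I_set)
qed

lemma Gamma_add_mult:
  assumes "I \<in> Gamma n" "a \<in> I"
  shows "a + n * k \<in> I"
proof (induction k)
  case 0
  then show ?case using assms by simp
next
  case (Suc k)
  then have "n + (a + n * k) \<in> I" using assms(1) by (simp add: Gamma_def)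
  then show ?case by (simp add: algebra_simps)
qed

lemma Gamma_infinite:
  assumes "I \<in> Gamma n"
  shows "infinite I"
proof
  assume "finite I"
  then have "finite (I \<union> - I)" using assms by (simp add: Gamma_def numerical_set_def)
  then show False by simp
qed

text \<open>If \<open>b\<close> were smaller, then adding \<open>n\<close> to \<open>b\<close> repeatedly would reach \<open>a - n\<close>, which is
  not in \<open>I\<close>.\<close>

lemma Gamma_Apery_le:
  assumes I: "I \<in> Gamma n" and a: "a \<in> Apery I n" and b: "b \<in> I" and m: "a mod n = b mod n"
  shows "a \<le> b"
proof (rule ccontr)
  assume "\<not> a \<le> b"
  then have "b < a" by simp
  then obtain k where k: "a = b + n * k" using m by (metis mod_eq_nat1E less_imp_le)
  with \<open>b < a\<close> obtain k' where "k = Suc k'" by (cases k) auto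
  then have "a = b + n * k' + n" using k by simp
  then have "n \<le> a" "a - n = b + n * k'" by auto
  then show False using a Gamma_add_mult[OF I b, of k'] by (simp add: Apery_iff)
qed

text \<open>Cofiniteness makes \<open>I\<close> meet every residue class, and the least element in a class is an
  Apery element.\<close>

lemma Gamma_Apery_ex:
  assumes I: "I \<in> Gamma n" and n: "0 < n"
  obtains a where "a \<in> Apery I n" "a mod n = r mod n"
proof -
  have fin: "finite (- I)" using I by (simp add: Gamma_def numerical_set_def)
  have "inj (\<lambda>k. r + n * k)" using n by (auto simp: inj_on_def)
  then have "infinite (range (\<lambda>k. r + n * k))" by (rule range_inj_infinite)
  then have "\<not> range (\<lambda>k. r + n * k) \<subseteq> - I" using fin finite_subset by blast
  then obtain k where "r + n * k \<in> I" by auto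
  then have ex: "\<exists>y. y \<in> I \<and> y mod n = r mod n"
    by (metis mod_mult_self2)
  define a where "a = (LEAST y. y \<in> I \<and> y mod n = r mod n)"
  have a: "a \<in> I" "a mod n = r mod n"
    using LeastI_ex[OF ex] by (auto simp: a_def)
  have "a - n \<notin> I" if "n \<le> a"
  proof
    assume "a - n \<in> I"
    moreover have "(a - n) mod n = r mod n" using a(2) that by (simp add: le_mod_geq)
    ultimately have "a \<le> a - n" unfolding a_def by (intro Least_le) simp
    then show False using n that by simp
  qed
  then show ?thesis using that[of a] a by (simp add: Apery_iff)
qed

lemma Gamma_ex_apery_list:
  assumes I: "I \<in> Gamma n" and n: "0 < n"
  obtains w where "apery_list n w" "I = I_set n (insert 0 (set w))"
proof -
  have inj: "inj_on (\<lambda>x. x mod n) (Apery I n)"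
    using Gamma_Apery_le[OF I] by (intro inj_onI) (metis Apery_iff le_antisym)
  have 0: "0 \<in> Apery I n"
    using I n by (auto simp: Apery_iff Gamma_def numerical_set_def)
  let ?A = "Apery I n - {0}"
  have img: "(\<lambda>x. x mod n) ` ?A = {1..n - 1}"
  proof (intro equalityI subsetI)
    fix r assume "r \<in> (\<lambda>x. x mod n) ` ?A"
    then obtain a where a: "a \<in> Apery I n" "a \<noteq> 0" "r = a mod n" by auto
    have "r \<noteq> 0" using inj_onD[OF inj _ a(1) 0] a by auto
    moreover have "r < n" using a(3) n by simp
    ultimately show "r \<in> {1..n - 1}" by auto
  next
    fix r assume r: "r \<in> {1..n - 1}"
    obtain a where a: "a \<in> Apery I n" "a mod n = r mod n"
      using Gamma_Apery_ex[OF I n] .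
    have "r < n" using r n by auto
    then have "r mod n = r" by simp
    then have "a \<noteq> 0" "r = a mod n" using a r by (auto intro: ccontr)
    then show "r \<in> (\<lambda>x. x mod n) ` ?A" using a(1) by blast
  qed
  have inj': "inj_on (\<lambda>x. x mod n) ?A" using inj by (rule inj_on_subset) auto
  have fin: "finite ?A"
    using finite_imageD[OF _ inj'] img by (metis finite_atLeastAtMost)
  define w where "w = sorted_list_of_set ?A"
  have w: "set w = ?A" "sorted_wrt (<) w" "distinct w" using fin by (auto simp: w_def)
  have "apery_list n w"
    unfolding apery_list_def using w img inj'
    by (auto simp: distinct_map intro!: permutations_of_setI)
  moreover have "insert 0 (set w) = Apery I n" using w(1) 0 by auto
  moreover have "I = I_set n (Apery I n)"
  proof (intro equalityI subsetI)
    fix y assume y: "y \<in> I"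
    obtain a where "a \<in> Apery I n" "a mod n = y mod n"
      using Gamma_Apery_ex[OF I n] .
    with Gamma_Apery_le[OF I this(1) y] show "y \<in> I_set n (Apery I n)"
      by (auto simp: mem_I_set)
  next
    fix y assume "y \<in> I_set n (Apery I n)"
    then obtain a k where "a \<in> I" "y = a + k * n" by (auto simp: I_set_def Apery_iff)
    then show "y \<in> I" using Gamma_add_mult[OF I, of a k] by (simp add: mult.commute)
  qed
  ultimately show ?thesis using that by simp
qed

section \<open>Positions of the Apery elements\<close>

text \<open>With quotients \<open>l\<close>, \<open>L\<close> and remainders \<open>s\<close>, \<open>S\<close> of \<open>a\<close> and \<open>x\<close>, the number \<open>a + n k\<close> lies
  below \<open>x\<close> for \<open>k < L - l\<close>, and also for \<open>k = L - l\<close> if \<open>s < S\<close>.\<close>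

lemma card_residue_class_between:
  fixes a x n :: nat
  assumes "a < x" "a mod n \<noteq> x mod n" "0 < n"
  shows "card {y. a \<le> y \<and> y < x \<and> y mod n = a mod n} + a div n
    = x div n + (if a mod n < x mod n then 1 else 0)"
proof -
  define b :: nat where "b = (if a mod n < x mod n then 1 else 0)"
  have le: "a div n \<le> x div n" using assms(1) by (simp add: div_le_mono)
  have iff: "a + n * k < x \<longleftrightarrow> k < x div n + b - a div n" for k
    using less_iff_div_mod[of "a + n * k" x n] le assms by (auto simp: b_def)
  have "{y. a \<le> y \<and> y < x \<and> y mod n = a mod n}
    = (\<lambda>k. a + n * k) ` {..<x div n + b - a div n}"
  proof (intro equalityI subsetI)
    fix y assume y: "y \<in> {y. a \<le> y \<and> y < x \<and> y mod n = a mod n}"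
    then obtain k where "y = a + n * k" by (auto elim: mod_eq_nat1E)
    then show "y \<in> (\<lambda>k. a + n * k) ` {..<x div n + b - a div n}" using y iff by auto
  qed (auto simp: iff)
  moreover have "inj_on (\<lambda>k. a + n * k) {..<x div n + b - a div n}"
    using assms(3) by (auto simp: inj_on_def)
  ultimately have "card {y. a \<le> y \<and> y < x \<and> y mod n = a mod n} = x div n + b - a div n"
    by (simp add: card_image)
  then show ?thesis using le by (simp add: b_def)
qed

text \<open>The elements below \<open>w ! i\<close> are sorted by residue class. Only the classes of \<open>0\<close> and of the
  \<open>w ! j\<close> with \<open>j < i\<close> have such elements, and the extra elements of these classes add up to the
  conversion entry of the residues at \<open>i\<close>.\<close>

lemma Apery_position:
  assumes w: "apery_list n w" and n: "0 < n" and i: "i < length w"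
  shows "card {y \<in> I_set n (insert 0 (set w)). y < w ! i} + (\<Sum>j<i. w ! j div n)
    = Suc (w ! i div n * Suc i + conversion_vector (map (\<lambda>x. x mod n) w) ! i)"
proof -
  define x where "x = w ! i"
  define C where "C a = {y. a \<le> y \<and> y < x \<and> y mod n = a mod n}" for a
  define B where "B = insert 0 ((!) w ` {..<i})"
  have less: "w ! j < x \<longleftrightarrow> j < i" if "j < length w" for j
    using apery_list_nth_less_iff[OF w that i] by (simp add: x_def)
  have pos: "0 < w ! j mod n" if "j < length w" for j
    using apery_list_mod_pos[OF w] that by simp
  have B_sub: "B \<subseteq> insert 0 (set w)" using i by (auto simp: B_def)
  have finC: "finite (C a)" for a by (rule finite_subset[of _ "{..<x}"]) (auto simp: C_def)
  have "{y \<in> I_set n (insert 0 (set w)). y < w ! i} = (\<Union>a\<in>B. C a)"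
  proof (intro equalityI subsetI)
    fix y assume "y \<in> {y \<in> I_set n (insert 0 (set w)). y < w ! i}"
    then obtain a where a: "a \<in> insert 0 (set w)" "a \<le> y" "y mod n = a mod n" "y < x"
      unfolding mem_I_set x_def by blast
    have "a \<in> B"
    proof (cases "a = 0")
      case False
      then obtain j where "j < length w" "a = w ! j" using a(1) by (metis in_set_conv_nth insertE)
      then show ?thesis using less[of j] a by (auto simp: B_def)
    qed (simp add: B_def)
    then show "y \<in> (\<Union>a\<in>B. C a)" using a by (auto simp: C_def)
  next
    fix y assume "y \<in> (\<Union>a\<in>B. C a)"
    then show "y \<in> {y \<in> I_set n (insert 0 (set w)). y < w ! i}"
      using B_sub by (auto simp: C_def mem_I_set x_def)
  qed
  also have "card \<dots> = (\<Sum>a\<in>B. card (C a))"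
  proof (rule card_UN_disjoint)
    show "\<forall>a\<in>B. \<forall>b\<in>B. a \<noteq> b \<longrightarrow> C a \<inter> C b = {}"
    proof (intro ballI impI)
      fix a b assume ab: "a \<in> B" "b \<in> B" "a \<noteq> b"
      then have "a mod n \<noteq> b mod n" using apery_list_inj[OF w] B_sub by blast
      then show "C a \<inter> C b = {}" by (auto simp: C_def)
    qed
  qed (auto simp: B_def finC)
  also have "\<dots> = card (C 0) + (\<Sum>j<i. card (C (w ! j)))"
  proof -
    have "0 \<notin> (!) w ` {..<i}"
    proof
      assume "0 \<in> (!) w ` {..<i}"
      then obtain j where j: "j < i" "w ! j = 0" by auto
      then have "0 < w ! j mod n" using pos[of j] i by linarith
      then show False using j(2) by simp
    qed
    moreover have "inj_on ((!) w) {..<i}"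
    proof (rule inj_onI)
      fix j k assume "j \<in> {..<i}" "k \<in> {..<i}" "w ! j = w ! k"
      then show "j = k" using apery_list_nth_mod_eq_iff[OF w, of j k] i by simp
    qed
    ultimately show ?thesis by (simp add: B_def sum.reindex)
  qed
  finally have card: "card {y \<in> I_set n (insert 0 (set w)). y < w ! i}
    = card (C 0) + (\<Sum>j<i. card (C (w ! j)))" .
  have "0 < x mod n" using pos[OF i] by (simp add: x_def)
  then have c0: "card (C 0) = Suc (x div n)"
    using card_residue_class_between[of 0 x n] n by (cases "x = 0") (auto simp: C_def)
  have cj: "card (C (w ! j)) + w ! j div n
      = x div n + (if w ! j mod n < w ! i mod n then 1 else 0)" if "j < i" for j
  proof -
    have j: "j < length w" using that i by simp
    have "w ! j mod n \<noteq> x mod n" using apery_list_nth_mod_eq_iff[OF w j i] that by (simp add: x_def)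
    then show ?thesis
      using card_residue_class_between[of "w ! j" x n] less[OF j] that n
      by (simp add: C_def x_def)
  qed
  have "(\<Sum>j<i. card (C (w ! j))) + (\<Sum>j<i. w ! j div n)
      = (\<Sum>j<i. x div n + (if w ! j mod n < w ! i mod n then 1 else 0))"
    unfolding sum.distrib[symmetric] using cj by (intro sum.cong) auto
  also have "\<dots> = i * (x div n) + card {j. j < i \<and> w ! j mod n < w ! i mod n}"
  proof -
    have "{j \<in> {..<i}. w ! j mod n < w ! i mod n} = {j. j < i \<and> w ! j mod n < w ! i mod n}"
      by auto
    then show ?thesis
      by (simp add: sum.distrib sum.If_cases Int_def)
  qed
  also have "{j. j < i \<and> w ! j mod n < w ! i mod n}
      = {j. j < i \<and> map (\<lambda>x. x mod n) w ! j < map (\<lambda>x. x mod n) w ! i}"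
    using i by auto
  finally show ?thesis
    using card c0 i by (simp add: nth_conversion_vector x_def algebra_simps)
qed

lemma card_less_enumerate:
  fixes I :: "nat set"
  assumes "infinite I"
  shows "card {y \<in> I. y < enumerate I k} = k"
proof -
  have "{y \<in> I. y < enumerate I k} = enumerate I ` {..<k}"
    using assms by (auto simp: enumerate_in_set) (metis enumerate_Ex enumerate_mono_iff imageI lessThan_iff)
  moreover have "inj_on (enumerate I) {..<k}"
    using inj_enumerate[OF assms] by (rule inj_on_subset) simp
  ultimately show ?thesis by (simp add: card_image)
qed

text \<open>The number of smaller elements inverts the enumeration of the set; so the positions are
  images of the Apery elements under a map that is increasing on the set.\<close>

lemma apery_positions_I_set:
  assumes w: "apery_list n w" and n: "0 < n"
  defines "I \<equiv> I_set n (insert 0 (set w))"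
  shows "apery_positions n I = map (\<lambda>x. card {y \<in> I. y < x}) w"
    and "sorted_wrt (<) (map (\<lambda>x. card {y \<in> I. y < x}) w)"
proof -
  let ?pos = "\<lambda>x. card {y \<in> I. y < x}"
  have IG: "I \<in> Gamma n" unfolding I_def using w n by (rule I_set_in_Gamma)
  then have inf: "infinite I" by (rule Gamma_infinite)
  have 0: "0 \<in> I" using IG by (simp add: Gamma_def numerical_set_def)
  have Ap: "Apery I n = insert 0 (set w)" unfolding I_def using w n by (rule Apery_I_set)
  have en: "enumerate I (?pos x) = x" if "x \<in> I" for x
    using enumerate_Ex[OF inf that] card_less_enumerate[OF inf] by metis
  have wI: "x \<in> I" if "x \<in> set w" for x using Ap that by (auto simp: Apery_iff)
  have mono: "?pos x < ?pos y" if "x \<in> set w" "y \<in> set w" "x < y" for x y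
    using that en[OF wI] enumerate_mono_iff[OF inf] by metis
  have w0: "x \<noteq> 0" if "x \<in> set w" for x using apery_list_mod_pos[OF w that] by (metis less_irrefl mod_0)
  have "{k. 0 < k \<and> enumerate I k \<in> Apery I n} = ?pos ` set w"
  proof (intro equalityI subsetI)
    fix k assume k: "k \<in> {k. 0 < k \<and> enumerate I k \<in> Apery I n}"
    then have "enumerate I 0 < enumerate I k" using inf by simp
    then have "enumerate I k \<in> set w" using k Ap by auto
    then show "k \<in> ?pos ` set w" using card_less_enumerate[OF inf, of k]
      by (intro image_eqI[where x = "enumerate I k"]) simp_all
  next
    fix k assume "k \<in> ?pos ` set w"
    then obtain x where x: "x \<in> set w" "k = ?pos x" by auto
    have "0 \<in> {y \<in> I. y < x}" using 0 w0[OF x(1)] by simp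
    then have "0 < k" unfolding x(2) by (subst card_gt_0_iff) auto
    moreover have "enumerate I k \<in> Apery I n"
      unfolding x(2) en[OF wI[OF x(1)]] Ap using x(1) by (rule insertI2)
    ultimately show "k \<in> {k. 0 < k \<and> enumerate I k \<in> Apery I n}" by simp
  qed
  moreover show sorted: "sorted_wrt (<) (map ?pos w)"
    unfolding sorted_wrt_map
    by (rule sorted_wrt_mono_rel[OF mono]) (use w in \<open>auto simp: apery_list_def\<close>)
  ultimately show "apery_positions n I = map ?pos w"
    unfolding apery_positions_def
    by (intro strict_sorted_equal) simp_all
qed

section \<open>The position vector and the recursion\<close>

text \<open>The last equation is the difference of the position formulas for \<open>i\<close> and \<open>Suc i\<close>; the sums
  of the earlier quotients cancel up to the term \<open>w ! i div n\<close>, which raises the factor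
  \<open>Suc i\<close> to \<open>Suc (Suc i)\<close>.\<close>

lemma pv_I_set:
  assumes w: "apery_list n w" and n: "0 < n"
  defines "I \<equiv> I_set n (insert 0 (set w))" and "r \<equiv> conversion_vector (map (\<lambda>x. x mod n) w)"
  shows pv_in_pos_vectors: "pv n I \<in> pos_vectors (n - 1)"
    and pv_nth_0: "0 < length w \<Longrightarrow> pv n I ! 0 = Suc (w ! 0 div n)"
    and pv_nth_Suc: "\<And>i. Suc i < length w \<Longrightarrow>
      pv n I ! Suc i + r ! i + w ! i div n * Suc (Suc i)
        = w ! Suc i div n * Suc (Suc i) + r ! Suc i"
proof -
  let ?pos = "\<lambda>x. card {y \<in> I. y < x}"
  have x: "apery_positions n I = map ?pos w" "sorted_wrt (<) (map ?pos w)"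
    using apery_positions_I_set[OF w n] by (simp_all add: I_def)
  have pv: "pv n I = map (\<lambda>i. if i = 0 then ?pos (w ! 0)
      else ?pos (w ! i) - ?pos (w ! (i - 1))) [0..<length w]"
    unfolding pv_def Let_def x(1) by (auto intro!: map_cong)
  have step: "?pos (w ! i) < ?pos (w ! Suc i)" if "Suc i < length w" for i
    using sorted_wrt_nth_less[OF x(2), of i "Suc i"] that by simp
  have pos: "?pos (w ! i) + (\<Sum>j<i. w ! j div n) = Suc (w ! i div n * Suc i + r ! i)"
    if "i < length w" for i
    using Apery_position[OF w n that] by (simp add: I_def r_def)
  have r0: "r ! 0 = 0" if "0 < length w"
    using conversion_vector_le[of 0 "map (\<lambda>x. x mod n) w"] that by (simp add: r_def)
  show nth0: "pv n I ! 0 = Suc (w ! 0 div n)" if "0 < length w"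
    using pos[OF that] r0[OF that] that by (simp add: pv)
  have nthS: "pv n I ! Suc i = ?pos (w ! Suc i) - ?pos (w ! i)" if "Suc i < length w" for i
    using that by (simp add: pv del: upt_Suc)
  have "0 < pv n I ! i" if "i < length w" for i
    using that nth0 nthS step by (cases i) auto
  moreover have "length (pv n I) = length w" by (simp add: pv)
  ultimately show "pv n I \<in> pos_vectors (n - 1)"
    using apery_list_length[OF w] by (auto simp: pos_vectors_def in_set_conv_nth)
  show "pv n I ! Suc i + r ! i + w ! i div n * Suc (Suc i)
      = w ! Suc i div n * Suc (Suc i) + r ! Suc i" if "Suc i < length w" for i
  proof -
    have "(\<Sum>j<Suc i. w ! j div n) = (\<Sum>j<i. w ! j div n) + w ! i div n" by simp
    then show ?thesis
      using pos[of i] pos[of "Suc i"] step[OF that] nthS[OF that] that by simp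
  qed
qed

text \<open>The recursion recovers the conversion vector of the residues and the quotients from the
  position vector, and these two determine the Apery elements.\<close>

lemma A_set_pv:
  assumes w: "apery_list n w" and n: "0 < n"
  shows "A_set n (pv n (I_set n (insert 0 (set w)))) = insert 0 (set w)"
proof -
  define v where "v = pv n (I_set n (insert 0 (set w)))"
  define r where "r = conversion_vector (map (\<lambda>x. x mod n) w)"
  have len: "length w = n - 1" using w by (rule apery_list_length)
  have v: "v \<in> pos_vectors (n - 1)" unfolding v_def by (rule pv_in_pos_vectors[OF w n])
  then have lenv: "length v = n - 1" by (simp add: pos_vectors_def)
  have r_le: "r ! i \<le> i" if "i < length w" for i
    using conversion_vector_le[of i "map (\<lambda>x. x mod n) w"] that by (simp add: r_def)
  have main: "t_entry v (Suc i) = r ! i \<and> l_entry v (Suc i) = w ! i div n" if "i < length w" for i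
    using that
  proof (induction i)
    case 0
    then show ?case using r_le[of 0] pv_nth_0[OF w n] by (simp add: v_def)
  next
    case (Suc i)
    \<comment> \<open>\<open>t_entry\<close> and the conversion entry are remainders of the same number modulo
      \<open>Suc (Suc i)\<close>, with quotients \<open>l_entry\<close> and \<open>w ! Suc i div n\<close>.\<close>
    have IH: "t_entry v (Suc i) = r ! i" "l_entry v (Suc i) = w ! i div n" using Suc by auto
    have "v ! Suc i + r ! i + w ! i div n * Suc (Suc i)
        = w ! Suc i div n * Suc (Suc i) + r ! Suc i"
      using pv_nth_Suc[OF w n Suc.prems] by (simp add: v_def r_def)
    then have eq: "l_entry v (Suc (Suc i)) * Suc (Suc i) + t_entry v (Suc (Suc i))
        = w ! Suc i div n * Suc (Suc i) + r ! Suc i"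
      using entry_recurrence[of v i] IH by simp
    have lt: "t_entry v (Suc (Suc i)) < Suc (Suc i)" "r ! Suc i < Suc (Suc i)"
      using t_entry_less[of "Suc (Suc i)" v] r_le[OF Suc.prems] by linarith+
    have "t_entry v (Suc (Suc i)) = r ! Suc i"
      using arg_cong[OF eq, of "\<lambda>a. a mod Suc (Suc i)"] lt
      by (simp only: mod_mult_self3 mod_less)
    moreover from this have "l_entry v (Suc (Suc i)) = w ! Suc i div n"
      using eq by (metis add_right_cancel mult_cancel2 nat.distinct(1))
    ultimately show ?case by blast
  qed
  have "conversion_vector (map (\<lambda>x. x mod n) w) = map (t_entry v) [1..<Suc (length v)]"
  proof (rule nth_equalityI)
    fix i assume "i < length (conversion_vector (map (\<lambda>x. x mod n) w))"
    then show "conversion_vector (map (\<lambda>x. x mod n) w) ! i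
        = map (t_entry v) [1..<Suc (length v)] ! i"
      using main[of i] len lenv by (simp add: r_def del: upt_Suc)
  qed (simp add: len lenv del: upt_Suc)
  then have sigma: "sigma_perm v = map (\<lambda>x. x mod n) w"
    using w lenv by (intro sigma_perm_eqI) (auto simp: apery_list_def)
  have "n * l_entry v i + sigma_perm v ! (i - 1) = w ! (i - 1)" if "1 \<le> i" "i \<le> n - 1" for i
    using main[of "i - 1"] that len by (simp add: sigma)
  then have "{n * l_entry v i + sigma_perm v ! (i - 1) | i. 1 \<le> i \<and> i \<le> n - 1}
      = {w ! (i - 1) | i. 1 \<le> i \<and> i \<le> n - 1}" by (metis (no_types, lifting))
  also have "\<dots> = set w"
  proof (intro equalityI subsetI)
    fix a assume "a \<in> set w"
    then obtain i where "i < n - 1" "a = w ! i" using len by (metis in_set_conv_nth)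
    then show "a \<in> {w ! (i - 1) | i. 1 \<le> i \<and> i \<le> n - 1}"
      by (intro CollectI exI[of _ "Suc i"]) simp
  qed (use len in auto)
  finally show ?thesis by (simp add: A_set_def v_def)
qed

text \<open>What has to be shown is that the elements of \<open>A_set n v\<close> are listed in increasing order; the
  positivity of \<open>v\<close> enters here.\<close>

lemma A_set_apery_list:
  assumes v: "v \<in> pos_vectors (n - 1)" and n: "0 < n"
  obtains w where "apery_list n w" "A_set n v = insert 0 (set w)"
    "map (\<lambda>x. x mod n) w = sigma_perm v"
    "\<And>i. i < length w \<Longrightarrow> w ! i div n = l_entry v (Suc i)"
proof -
  have lenv: "length v = n - 1" using v by (simp add: pos_vectors_def)
  let ?s = "sigma_perm v"
  have sp: "?s \<in> permutations_of_set {1..n - 1}" using sigma_perm_in[of v] lenv by simp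
  have lens: "length ?s = n - 1" using sp by (rule length_permutation)
  define w where "w = map (\<lambda>i. n * l_entry v (Suc i) + ?s ! i) [0..<n - 1]"
  have len: "length w = n - 1" by (simp add: w_def)
  have nth: "w ! i = n * l_entry v (Suc i) + ?s ! i" if "i < n - 1" for i
    using that by (simp add: w_def)
  have s_less: "?s ! i < n" if "i < n - 1" for i
  proof -
    have "?s ! i \<in> {1..n - 1}" using that lens permutations_of_setD(1)[OF sp] nth_mem by metis
    then show ?thesis using n by auto
  qed
  have div: "w ! i div n = l_entry v (Suc i)" and mod: "w ! i mod n = ?s ! i" if "i < n - 1" for i
    using s_less[OF that] nth[OF that] by simp_all
  have mods: "map (\<lambda>x. x mod n) w = ?s"
    by (rule nth_equalityI) (simp_all add: len lens mod)
  have conv: "conversion_vector ?s ! i = t_entry v (Suc i)" if "i < n - 1" for i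
    using that lenv by (simp add: conversion_vector_sigma_perm del: upt_Suc)
  have step: "w ! i < w ! Suc i" if i: "Suc i < n - 1" for i
  proof -
    have vpos: "0 < v ! Suc i" using v i lenv by (simp add: pos_vectors_def)
    let ?m = "Suc (Suc i)"
    have rec: "v ! Suc i + t_entry v (Suc i) + l_entry v (Suc i) * ?m
        = l_entry v ?m * ?m + t_entry v ?m" by (rule entry_recurrence)
    have le: "l_entry v (Suc i) \<le> l_entry v ?m" by simp
    show ?thesis
    proof (cases "l_entry v (Suc i) = l_entry v ?m")
      case False
      then show ?thesis using le div i less_iff_div_mod[of "w ! i" "w ! Suc i" n] by simp
    next
      case True
      \<comment> \<open>The positive entry of \<open>v\<close> is now the growth of the conversion entry, and at a descent
        the conversion entry could not grow.\<close>
      then have "t_entry v (Suc i) < t_entry v ?m" using rec vpos by simp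
      then have tl: "conversion_vector ?s ! i < conversion_vector ?s ! Suc i"
        using conv i by simp
      have "?s ! i < ?s ! Suc i"
      proof (rule ccontr)
        assume "\<not> ?s ! i < ?s ! Suc i"
        then have "card {j. j < Suc i \<and> ?s ! j < ?s ! Suc i} \<le> card {j. j < i \<and> ?s ! j < ?s ! i}"
          by (intro card_mono) (auto simp: less_Suc_eq)
        then show False using tl i lens by (simp add: nth_conversion_vector)
      qed
      then show ?thesis using True nth i by simp
    qed
  qed
  have "sorted_wrt (<) w"
    unfolding sorted_wrt_iff_nth_Suc_transp[OF transp_on_less] using step len by simp
  then have "apery_list n w" using sp by (simp add: apery_list_def mods)
  moreover have "A_set n v = insert 0 (set w)"
  proof -
    have "{n * l_entry v i + ?s ! (i - 1) | i. 1 \<le> i \<and> i \<le> n - 1} = set w"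
    proof (intro equalityI subsetI)
      fix a assume "a \<in> {n * l_entry v i + ?s ! (i - 1) | i. 1 \<le> i \<and> i \<le> n - 1}"
      then obtain i where i: "1 \<le> i" "i \<le> n - 1" "a = n * l_entry v i + ?s ! (i - 1)" by auto
      then have "a = w ! (i - 1)" using nth[of "i - 1"] by simp
      then show "a \<in> set w" using i len by simp
    next
      fix a assume "a \<in> set w"
      then obtain i where "i < n - 1" "a = w ! i" using len by (metis in_set_conv_nth)
      then show "a \<in> {n * l_entry v i + ?s ! (i - 1) | i. 1 \<le> i \<and> i \<le> n - 1}"
        using nth by (intro CollectI exI[of _ "Suc i"]) simp
    qed
    then show ?thesis by (simp add: A_set_def)
  qed
  ultimately show ?thesis using that[of w] mods div len by simp
qed

text \<open>The vector \<open>v\<close> and the position vector satisfy the same equation in the same quotients and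
  conversion entries, and the equation determines the vector.\<close>

lemma pv_I_set_A_set:
  assumes v: "v \<in> pos_vectors (n - 1)" and n: "0 < n"
  shows "pv n (I_set n (A_set n v)) = v"
proof -
  have lenv: "length v = n - 1" using v by (simp add: pos_vectors_def)
  obtain w where w: "apery_list n w" "A_set n v = insert 0 (set w)"
    "map (\<lambda>x. x mod n) w = sigma_perm v"
    and l: "\<And>i. i < length w \<Longrightarrow> w ! i div n = l_entry v (Suc i)"
    using A_set_apery_list[OF v n] by metis
  have len: "length w = n - 1" using w(1) by (rule apery_list_length)
  let ?I = "I_set n (insert 0 (set w))"
  have conv: "conversion_vector (map (\<lambda>x. x mod n) w) ! i = t_entry v (Suc i)" if "i < n - 1" for i
    using that lenv by (simp add: w(3) conversion_vector_sigma_perm del: upt_Suc)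
  have "pv n ?I = v"
  proof (rule nth_equalityI)
    show lens: "length (pv n ?I) = length v"
      using pv_in_pos_vectors[OF w(1) n] lenv by (simp add: pos_vectors_def)
    fix i assume "i < length (pv n ?I)"
    then have i: "i < n - 1" using lens lenv by simp
    show "pv n ?I ! i = v ! i"
    proof (cases i)
      case 0
      have "0 < v ! 0" using v i lenv by (simp add: pos_vectors_def)
      then show ?thesis using pv_nth_0[OF w(1) n] l[of 0] i len 0 by simp
    next
      case (Suc k)
      then have k: "k < n - 1" "Suc k < n - 1" using i by auto
      have "pv n ?I ! Suc k + t_entry v (Suc k) + l_entry v (Suc k) * Suc (Suc k)
          = l_entry v (Suc (Suc k)) * Suc (Suc k) + t_entry v (Suc (Suc k))"
        using pv_nth_Suc[OF w(1) n, of k] conv[OF k(1)] conv[OF k(2)] l[of k] l[of "Suc k"] k len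
        by (simp only: len)
      then have "pv n ?I ! Suc k = v ! Suc k" using entry_recurrence[of v k] by linarith
      then show ?thesis using Suc by simp
    qed
  qed
  then show ?thesis by (simp add: w(2))
qed

section \<open>The bijection\<close>

theorem theorem2p10:
  fixes n :: nat and f :: "nat set \<Rightarrow> nat list" and g :: "nat list \<Rightarrow> nat set"
  assumes "n \<ge> 1"
  defines "f \<equiv> (\<lambda>I. pv n I)" and "g \<equiv> (\<lambda>v. I_set n (A_set n v))"
  shows "f \<in> Gamma n \<rightarrow> pos_vectors (n - 1)
    \<and> g \<in> pos_vectors (n - 1) \<rightarrow> Gamma n
    \<and> (\<forall>I\<in>Gamma n. g (f I) = I)
    \<and> (\<forall>v\<in>pos_vectors (n - 1). f (g v) = v)
    \<and> bij_betw f (Gamma n) (pos_vectors (n - 1))"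
proof -
  have n: "0 < n" using assms(1) by simp
  have f: "f I \<in> pos_vectors (n - 1)" and gf: "g (f I) = I" if I: "I \<in> Gamma n" for I
  proof -
    obtain w where w: "apery_list n w" "I = I_set n (insert 0 (set w))"
      using Gamma_ex_apery_list[OF I n] .
    show "f I \<in> pos_vectors (n - 1)" using pv_in_pos_vectors[OF w(1) n] w(2) by (simp add: f_def)
    show "g (f I) = I" using A_set_pv[OF w(1) n] w(2) by (simp add: f_def g_def)
  qed
  have g: "g v \<in> Gamma n" and fg: "f (g v) = v" if v: "v \<in> pos_vectors (n - 1)" for v
  proof -
    obtain w where "apery_list n w" "A_set n v = insert 0 (set w)"
      using A_set_apery_list[OF v n] by metis
    then show "g v \<in> Gamma n" using I_set_in_Gamma n by (simp add: g_def)
    show "f (g v) = v" using pv_I_set_A_set[OF v n] by (simp add: f_def g_def)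
  qed
  have "bij_betw f (Gamma n) (pos_vectors (n - 1))"
    using f g fg gf by (intro bij_betw_byWitness[where f' = g]) auto
  then show ?thesis using f g fg gf by auto
qed

end
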